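(* Let $X=\{0,1\}$ and let $d$ be the standard ultrametric distance on $X^{\omega}$. (1) Let $(X^{\omega},d,\delta)$ be a dilatation structure such that $p_0=0$. Then there exists a smooth function $$W:\mathbb{N}^{*}\times X^{\omega}\to \mathrm{Isom}(X^{\omega}),\qquad W(n,x)=W^{x}_{n},$$ such that for any $q\in X^{*}$, $\alpha\in X$, $x,y\in X^{\omega}$ we have $$\delta_{2}^{q\alpha x}\, q\bar{\alpha}y \;=\; q\,\alpha\,\overline{x_{1}}\; W^{q\alpha x}_{|q|+1}(y). \qquad ( * )$$ (2) Conversely, let $W:\mathbb{N}^{*}\times X^{\omega}\to \mathrm{Isom}(X^{\omega})$ be any smooth function. Define, for each $x\in X^\omega$, the map $\delta_2^x:X^\omega\to X^\omega$ by $\delta_2^x x=x$ and, for arguments different from the base point, by relation $( * )$. Then the maps $\delta_2^x$ induce (by $\delta_{1}^x=\mathrm{id}$, $\delta^x_{2^p}=(\delta^x_2)^p$ for $p\ge 1$, and $\delta^x_{2^{-p}}$ the inverse of $\delta^x_{2^p}$) a dilatation structure $(X^{\omega},d,\delta)$ with $p_0=0$.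
   Context: **Words.** $X=\{0,1\}$; $X^{*}$ is the set of finite words over $X$ (including the empty word), $|q|$ is the length of $q\in X^*$; $X^{\omega}=X^{\mathbb{N}^{*}}$ is the set of right-infinite words, $\mathbb{N}^*=\{1,2,\dots\}$, $\mathbb N=\{0,1,2,\dots\}$. Concatenation is written by juxtaposition; $x_1$ is the first letter of $x\in X^\omega$; for a letter $\alpha\in X$, $\bar\alpha$ is the other letter. $[x]_p$ is the prefix of length $p$ of $x$. The standard distance is $d(x,x)=0$ and $d(q\alpha x,q\bar\alpha y)=2^{-|q|}$ for $q\in X^*,\alpha\in X,x,y\in X^\omega$; it is an ultrametric and $X^\omega$ is compact. $\mathrm{Isom}(X^\omega)$ is the set of isometries of $(X^\omega,d)$. Balls are $B(x,r)=\{y: d(x,y)\le r\}$, so $B(x,2^{-p})=[x]_pX^\omega$ and $B(x,1)=X^\omega$. **Dilatation structure on $(X^\omega,d)$.** Let $\Gamma=\{2^p: p\in\mathbb{Z}\}\subset\mathbb{Q}_2$ (dyadic numbers) with multiplication and $\nu(2^p)=2^{-p}$ (so $2^p\to 0$ means $p\to+\infty$); $\bar\Gamma=\Gamma\cup\{0\}$, where neighbourhoods of $0$ are generated by the sets $\{0\}\cup\{2^p: p> m\}$. A dilatation structure $(X^\omega,d,\delta)$ is a family of maps $\delta^x_{2^p}$ ($x\in X^\omega$, $p\in\mathbb{Z}$) satisfying: - A0. For $p\in\mathbb{N}$, $\delta^x_{2^p}:X^\omega\to V_{2^p}(x)$ is a homeomorphism onto an open neighbourhood $V_{2^p}(x)$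 of $x$, and $B(x,2^{-p})\subset\delta^x_{2^p}X^\omega\subset V_{2^p}(x)$. For $p\in\mathbb{N}^*$, $\delta^x_{2^{-p}}:W_{2^{-p}}(x)\to X^\omega$ is injective, invertible on its image, $W_{2^{-p}}(x)$ is an open neighbourhood of $x$, $V_{2^p}(x)\subset W_{2^{-p}}(x)$, and $\delta^x_{2^{-p}}\delta^x_{2^p}u=u$ for all $u\in X^\omega$. Moreover there are $R>0$ and $p_1\in\mathbb{N}$ such that $\delta^x_{2^p}v\in W_{2^{-p}}(\delta^x_{2^p}u)$ for all $x$, all $u,v\in B(x,R)$ and all $p> p_1$. - A1. $\delta^x_{2^p}x=x$ and $\delta^x_1=\mathrm{id}$. Let $\mathrm{dom}\,\delta$ be the set of $(2^p,x,y)\in\Gamma\times X^\omega\times X^\omega$ with $y$ arbitrary if $p\ge0$ and $y\in W_{2^p}(x)$ if $p<0$. The map $(\varepsilon,x,y)\mapsto\delta^x_\varepsilon y$ is continuous on $\mathrm{dom}\,\delta$ and extends continuously to the closure of $\mathrm{dom}\,\delta$ in $\bar\Gamma\times X^\omega\times X^\omega$, with $\lim_{\varepsilon\to0}\delta^x_\varepsilon y=x$. - A2. $\delta^x_{2^p}\delta^x_{2^{r}}u=\delta^x_{2^{p+r}}u$ for all $p,r\in\mathbb{N}$, $x,u\in X^\omega$. - A3. For each $x$ there is a function $d^x:X^\omega\times X^\omega\to[0,\infty)$, non-degenerate ($d^x(u,v)=0$ only if $u=v$), with $\lim_{p\to\infty}2^p d(\delta^x_{2^p}u,\delta^x_{2^p}v)=d^x(u,v)$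 uniformly in $x,u,v\in X^\omega$. **The number $p_0$.** $p_0$ denotes the smallest natural number such that $2^p d(\delta^x_{2^p}u,\delta^x_{2^p}v)=d^x(u,v)$ for all $x,u,v\in X^\omega$ and all $p\in\mathbb{N}$, $p\ge p_0$. **Smooth.** A function $W:\mathbb{N}^*\times X^\omega\to\mathrm{Isom}(X^\omega)$, $W(k,x)=W^x_k$, is smooth if for any $\varepsilon>0$ there exists $\mu(\varepsilon)>0$ such that for any $x,x'\in X^\omega$ with $d(x,x')<\mu(\varepsilon)$ and any $y\in X^\omega$ we have $$\frac{1}{2^k}\,d(W^x_k(y),W^{x'}_k(y))\le\varepsilon$$ for any $k\in\mathbb{N}^*$ such that $d(x,x')<1/2^k$. *)

theory Defs
  imports "HOL-Analysis.Analysis" "HOL-Library.Stream"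
begin

text \<open>
  Finite words over \<open>X = {0,1}\<close> are of type \<^typ>\<open>bool list\<close>, infinite words of type
  \<^typ>\<open>bool stream\<close>; \<^const>\<open>Not\<close> is the bar on letters. The stream
  position \<open>n\<close> (counted from \<open>0\<close>) of \<open>x\<close> is the letter that is
  traditionally written \<open>x\<^sub>n\<^sub>+\<^sub>1\<close>.
\<close>

instantiation stream :: (type) metric_space
begin

definition dist_stream_def:
  "dist x y = (if x = y then 0 else 1 / 2 ^ (LEAST n. x !! n \<noteq> y !! n))"
  for x y :: "'a stream"

definition uniformity_stream_def:
  "(uniformity :: ('a stream \<times> 'a stream) filter) =
     (INF e\<in>{0<..}. principal {(x, y). dist x y < e})"

definition open_stream_def:
  "open (U :: 'a stream set) \<longleftrightarrow>
     (\<forall>x\<in>U. eventually (\<lambda>(x', y). x' = x \<longrightarrow> y \<in> U) uniformity)"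

instance
proof
  fix x y z :: "'a stream"
  show "dist x y = 0 \<longleftrightarrow> x = y"
    by (simp add: dist_stream_def)
  show "dist x y \<le> dist x z + dist y z"
  proof (cases "x = y \<or> x = z \<or> y = z")
    case True
    have sym: "dist z y = dist y z"
      unfolding dist_stream_def by (simp only: eq_commute[of "z"] eq_commute[of "z !! _"])
    have "dist x y \<ge> 0" "dist y y = 0" for x y :: "'a stream"
      by (simp_all add: dist_stream_def)
    then show ?thesis
      using True sym by auto
  next
    case False
    define m where "m = (LEAST n. x !! n \<noteq> y !! n)"
    define k where "k = (LEAST n. x !! n \<noteq> z !! n)"
    define l where "l = (LEAST n. y !! n \<noteq> z !! n)"
    have "\<exists>n. x !! n \<noteq> y !! n"
    proof (rule ccontr)
      assume "\<nexists>n. x !! n \<noteq> y !! n"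
      then have "snth x = snth y"
        by (auto intro: ext)
      then have "smap (snth x) nats = smap (snth y) nats"
        by (rule arg_cong)
      then show False
        using False by (simp flip: stream_smap_nats)
    qed
    then have m: "x !! m \<noteq> y !! m"
      unfolding m_def by (rule LeastI_ex)
    then have "x !! m \<noteq> z !! m \<or> y !! m \<noteq> z !! m"
      by auto
    then have "k \<le> m \<or> l \<le> m"
      unfolding k_def l_def by (auto intro: Least_le)
    then have "(1::real) / 2 ^ m \<le> 1 / 2 ^ k \<or> (1::real) / 2 ^ m \<le> 1 / 2 ^ l"
      by (auto intro!: divide_left_mono power_increasing)
    moreover have "(0::real) \<le> 1 / 2 ^ k" "(0::real) \<le> 1 / 2 ^ l"
      by simp_all
    ultimately have "(1::real) / 2 ^ m \<le> 1 / 2 ^ k + 1 / 2 ^ l"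
      by linarith
    with False show ?thesis
      by (simp add: dist_stream_def m_def k_def l_def)
  qed
qed (simp_all only: uniformity_stream_def open_stream_def)

end

lemma dist_branching:
  "dist (q @- \<alpha> ## x) (q @- (\<not> \<alpha>) ## y) = 1 / 2 ^ length q"
proof -
  let ?u = "q @- \<alpha> ## x" and ?v = "q @- (\<not> \<alpha>) ## y"
  have at: "?u !! length q \<noteq> ?v !! length q"
    by simp
  have "(LEAST n. ?u !! n \<noteq> ?v !! n) = length q"
  proof (rule Least_equality)
    show "?u !! length q \<noteq> ?v !! length q"
      by (rule at)
    fix n assume "?u !! n \<noteq> ?v !! n"
    then show "length q \<le> n"
      by (cases "n < length q") simp_all
  qed
  moreover have "?u \<noteq> ?v"
    using at by (rule contrapos_nn) (simp only:)
  ultimately show ?thesis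
    by (simp add: dist_stream_def)
qed

definition Isom :: "(bool stream \<Rightarrow> bool stream) set" where
  "Isom = {f. bij f \<and> (\<forall>u v. dist (f u) (f v) = dist u v)}"

text \<open>
  \<open>Pow2 p\<close> stands for the dyadic number \<open>2\<^sup>p\<close>, so that the type is
  \<open>\<Gamma> \<union> {0}\<close>. As in the 2-adic numbers, \<open>2\<^sup>p\<close> tends to \<open>0\<close>
  when \<open>p\<close> tends to \<open>+\<infinity>\<close>, and \<open>\<Gamma>\<close> is discrete.
\<close>

datatype scale = Zero | Pow2 (expo: int)

instantiation scale :: topological_space
begin

definition open_scale_def:
  "open (U :: scale set) \<longleftrightarrow> (Zero \<in> U \<longrightarrow> (\<exists>m. \<forall>p>m. Pow2 p \<in> U))"

instance
proof
  show "open (UNIV :: scale set)"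
    by (simp add: open_scale_def)
next
  fix S T :: "scale set"
  assume S: "open S" and T: "open T"
  show "open (S \<inter> T)"
    unfolding open_scale_def
  proof
    assume "Zero \<in> S \<inter> T"
    with S T obtain m n where "\<forall>p>m. Pow2 p \<in> S" "\<forall>p>n. Pow2 p \<in> T"
      unfolding open_scale_def by auto
    then have "\<forall>p>max m n. Pow2 p \<in> S \<inter> T"
      by simp
    then show "\<exists>m. \<forall>p>m. Pow2 p \<in> S \<inter> T" ..
  qed
next
  fix K :: "scale set set"
  assume "\<forall>S\<in>K. open S"
  then show "open (\<Union>K)"
    unfolding open_scale_def by (meson UnionE UnionI)
qed

end

text \<open>
  \<open>\<delta> p x\<close> is the map of coefficient \<open>2\<^sup>p\<close> based at \<open>x\<close>. For
  \<open>p \<ge> 0\<close> it is defined everywhere, with image \<open>V p x\<close>. The map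
  \<open>\<delta> (- int p) x\<close> with \<open>p \<ge> 1\<close> has domain \<open>W p x\<close>; thus \<open>W p x\<close> is
  the set usually indexed by \<open>2\<^sup>-\<^sup>p\<close>. The values of the total function
  \<open>\<delta> (- int p) x\<close> outside \<open>W p x\<close> are irrelevant: no axiom mentions them.
\<close>

type_synonym dilatations = "int \<Rightarrow> bool stream \<Rightarrow> bool stream \<Rightarrow> bool stream"
type_synonym domains = "nat \<Rightarrow> bool stream \<Rightarrow> bool stream set"

definition axiom_A0 :: "dilatations \<Rightarrow> domains \<Rightarrow> domains \<Rightarrow> bool" where
  "axiom_A0 \<delta> V W \<longleftrightarrow>
     (\<forall>p::nat. \<forall>x.
        open (V p x) \<and> x \<in> V p x \<and>
        (\<exists>g. homeomorphism UNIV (V p x) (\<delta> (int p) x) g) \<and>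
        cball x (1 / 2 ^ p) \<subseteq> range (\<delta> (int p) x) \<and> range (\<delta> (int p) x) \<subseteq> V p x) \<and>
     (\<forall>p::nat. p \<ge> 1 \<longrightarrow> (\<forall>x.
        inj_on (\<delta> (- int p) x) (W p x) \<and>
        open (W p x) \<and> x \<in> W p x \<and> V p x \<subseteq> W p x \<and>
        (\<forall>u. \<delta> (- int p) x (\<delta> (int p) x u) = u))) \<and>
     (\<exists>R>0. \<exists>p1::nat. \<forall>x. \<forall>u\<in>cball x R. \<forall>v\<in>cball x R. \<forall>p>p1.
        \<delta> (int p) x v \<in> W p (\<delta> (int p) x u))"

definition dom_dil :: "domains \<Rightarrow> (scale \<times> bool stream \<times> bool stream) set" where
  "dom_dil W = {(Pow2 p, x, y) | p x y. p < 0 \<longrightarrow> y \<in> W (nat (- p)) x}"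

definition axiom_A1 :: "dilatations \<Rightarrow> domains \<Rightarrow> bool" where
  "axiom_A1 \<delta> W \<longleftrightarrow>
     (\<forall>p x. \<delta> p x x = x) \<and> (\<forall>x. \<delta> 0 x = id) \<and>
     continuous_on (dom_dil W) (\<lambda>(\<epsilon>, x, y). \<delta> (expo \<epsilon>) x y) \<and>
     (\<exists>F. continuous_on (closure (dom_dil W)) F \<and>
          (\<forall>(\<epsilon>, x, y)\<in>dom_dil W. F (\<epsilon>, x, y) = \<delta> (expo \<epsilon>) x y)) \<and>
     (\<forall>x y. ((\<lambda>p. \<delta> p x y) \<longlongrightarrow> x) at_top)"

definition axiom_A2 :: "dilatations \<Rightarrow> bool" where
  "axiom_A2 \<delta> \<longleftrightarrow>
     (\<forall>(p::nat) (r::nat) x u. \<delta> (int p) x (\<delta> (int r) x u) = \<delta> (int (p + r)) x u)"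

definition axiom_A3 :: "dilatations \<Rightarrow> bool" where
  "axiom_A3 \<delta> \<longleftrightarrow>
     (\<exists>D :: bool stream \<Rightarrow> bool stream \<Rightarrow> bool stream \<Rightarrow> real.
        (\<forall>x u v. 0 \<le> D x u v) \<and> (\<forall>x u v. D x u v = 0 \<longrightarrow> u = v) \<and>
        uniform_limit UNIV
          (\<lambda>p (x, u, v). 2 ^ p * dist (\<delta> (int p) x u) (\<delta> (int p) x v))
          (\<lambda>(x, u, v). D x u v) sequentially)"

definition dilatation_structure :: "dilatations \<Rightarrow> domains \<Rightarrow> domains \<Rightarrow> bool" where
  "dilatation_structure \<delta> V W \<longleftrightarrow>
     axiom_A0 \<delta> V W \<and> axiom_A1 \<delta> W \<and> axiom_A2 \<delta> \<and> axiom_A3 \<delta>"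

text \<open>The function \<open>d\<^sup>x\<close> of the last axiom, which is determined by \<open>\<delta>\<close>.\<close>

definition tangent_dist :: "dilatations \<Rightarrow> bool stream \<Rightarrow> bool stream \<Rightarrow> bool stream \<Rightarrow> real" where
  "tangent_dist \<delta> x u v = lim (\<lambda>p. 2 ^ p * dist (\<delta> (int p) x u) (\<delta> (int p) x v))"

definition stable_from :: "dilatations \<Rightarrow> nat \<Rightarrow> bool" where
  "stable_from \<delta> n \<longleftrightarrow>
     (\<forall>x u v. \<forall>p\<ge>n. 2 ^ p * dist (\<delta> (int p) x u) (\<delta> (int p) x v) = tangent_dist \<delta> x u v)"

text \<open>\<open>is_p0 \<delta> n\<close> means that \<open>p\<^sub>0\<close> exists and equals \<open>n\<close>.\<close>

definition is_p0 :: "dilatations \<Rightarrow> nat \<Rightarrow> bool" where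
  "is_p0 \<delta> n \<longleftrightarrow> stable_from \<delta> n \<and> (\<forall>m. stable_from \<delta> m \<longrightarrow> n \<le> m)"

text \<open>The index of \<open>W\<close> ranges over the positive integers; \<open>W 0\<close> is irrelevant.\<close>

definition smooth_family :: "(nat \<Rightarrow> bool stream \<Rightarrow> bool stream \<Rightarrow> bool stream) \<Rightarrow> bool" where
  "smooth_family W \<longleftrightarrow>
     (\<forall>k\<ge>1. \<forall>x. W k x \<in> Isom) \<and>
     (\<forall>\<epsilon>>0. \<exists>\<mu>>0. \<forall>x x'. dist x x' < \<mu> \<longrightarrow>
        (\<forall>y. \<forall>k\<ge>1. dist x x' < 1 / 2 ^ k \<longrightarrow>
           1 / 2 ^ k * dist (W k x y) (W k x' y) \<le> \<epsilon>))"

definition represents ::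
    "(nat \<Rightarrow> bool stream \<Rightarrow> bool stream \<Rightarrow> bool stream) \<Rightarrow>
     (bool stream \<Rightarrow> bool stream \<Rightarrow> bool stream) \<Rightarrow> bool" where
  "represents W \<delta>2 \<longleftrightarrow>
     (\<forall>q \<alpha> x y.
        \<delta>2 (q @- \<alpha> ## x) (q @- (\<not> \<alpha>) ## y) =
        q @- \<alpha> ## (\<not> shd x) ## W (length q + 1) (q @- \<alpha> ## x) y)"

text \<open>
  For \<open>p < 0\<close> the inverse is meaningful on the range of \<open>\<delta>2 x ^^ nat (- p)\<close>, which
  \<open>induced_domains\<close> records as its domain.
\<close>

definition induced :: "(bool stream \<Rightarrow> bool stream \<Rightarrow> bool stream) \<Rightarrow> dilatations" where
  "induced \<delta>2 p x = (if p \<ge> 0 then \<delta>2 x ^^ nat p else inv (\<delta>2 x ^^ nat (- p)))"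

definition induced_domains :: "(bool stream \<Rightarrow> bool stream \<Rightarrow> bool stream) \<Rightarrow> domains" where
  "induced_domains \<delta>2 p x = range (\<delta>2 x ^^ p)"

end

theory Submission imports Defs begin

text \<open>
  With \<open>p\<^sub>0 = 0\<close> every \<open>\<delta>\<^sub>2\<^sup>x\<close> is a similarity of ratio \<open>1/2\<close> of
  \<open>X\<^sup>\<omega>\<close> onto the ball of radius \<open>1/2\<close> around its fixed point \<open>x\<close>. Such a map sends the
  sphere \<open>q \<alpha>' X\<^sup>\<omega>\<close> (\<open>\<alpha>'\<close> the other letter) around \<open>q \<alpha> x\<close> onto the next
  smaller sphere, and is there, up to prefixes, an isometry \<open>W\<close>; conversely, isometries
  between consecutive spheres glue to a similarity because the distance between points of
  different spheres is the larger radius. Smoothness of \<open>W\<close> amounts to uniform continuity of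
  \<open>(x, y) \<mapsto> \<delta>\<^sub>2\<^sup>x y\<close>, hence, by compactness, to its continuity.
\<close>

section \<open>The ultrametric on infinite words\<close>

lemma stream_eq_iff_snth: "x = y \<longleftrightarrow> (\<forall>n. x !! n = y !! n)" for x y :: "'a stream"
  by (metis ext stream_smap_nats)

text \<open>Splitting after the longest common prefix brings any two distinct words into the form in
  which \<open>dist_branching\<close> and \<open>represents\<close> apply.\<close>

lemma stream_branch:
  fixes x y :: "bool stream"
  assumes "x \<noteq> y"
  obtains q \<alpha> x' y' where "x = q @- \<alpha> ## x'" "y = q @- (\<not> \<alpha>) ## y'"
proof -
  define n where "n = (LEAST n. x !! n \<noteq> y !! n)"
  have "\<exists>n. x !! n \<noteq> y !! n"
    using assms by (simp add: stream_eq_iff_snth)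
  then have n: "x !! n \<noteq> y !! n"
    unfolding n_def by (rule LeastI_ex)
  have "x !! i = y !! i" if "i < n" for i
    using not_less_Least[OF that[unfolded n_def]] by blast
  then have stake: "stake n x = stake n y"
    by (simp add: list_eq_iff_nth_eq)
  have split: "z = stake n z @- (z !! n) ## sdrop (Suc n) z" for z :: "bool stream"
    by (rule id_stake_snth_sdrop)
  have letter: "(\<not> x !! n) = y !! n"
    using n by simp
  have "y = stake n x @- (\<not> x !! n) ## sdrop (Suc n) y"
    unfolding letter stake by (rule split)
  with split[of x] show thesis
    by (rule that)
qed

lemma dist_shift: "dist (q @- x) (q @- y) = dist x y / 2 ^ length q" for x y :: "bool stream"
proof (cases "x = y")
  case False
  then obtain r \<alpha> x' y' where "x = r @- \<alpha> ## x'" "y = r @- (\<not> \<alpha>) ## y'"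
    by (rule stream_branch)
  then show ?thesis
    using dist_branching[of "q @ r" \<alpha> x' y'] dist_branching[of r \<alpha> x' y']
    by (simp add: power_add)
qed simp

lemma dist_SCons: "dist (a ## x) (a ## y) = dist x y / 2" for x y :: "bool stream"
  using dist_shift[of "[a]"] by simp

lemma half_power_le_iff: "(1::real) / 2 ^ m \<le> 1 / 2 ^ n \<longleftrightarrow> n \<le> m"
  by (simp add: field_simps)

text \<open>Balls of radius 1/2^n are cylinders. Equality of prefixes is transitive, which is the
  source of the ultrametric inequality.\<close>

lemma dist_le_iff_stake: "dist x y \<le> 1 / 2 ^ n \<longleftrightarrow> stake n x = stake n y" for x y :: "bool stream"
proof (cases "x = y")
  case False
  then obtain q \<alpha> x' y' where xy: "x = q @- \<alpha> ## x'" "y = q @- (\<not> \<alpha>) ## y'"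
    by (rule stream_branch)
  have "stake n x = stake n y \<longleftrightarrow> n \<le> length q"
  proof
    assume eq: "stake n x = stake n y"
    show "n \<le> length q"
    proof (rule ccontr)
      assume "\<not> n \<le> length q"
      then have "x !! length q = y !! length q"
        using eq by (metis not_le stake_nth)
      then show False
        by (simp add: xy)
    qed
  qed (simp add: xy stake_shift)
  then show ?thesis
    by (simp add: xy dist_branching half_power_le_iff)
qed simp

text \<open>Distances are powers of two, so a strict bound gains one letter: with n = |q| + 1 the
  proviso in the definition of smoothness becomes agreement on |q| + 2 letters.\<close>

lemma dist_less_imp_stake:
  fixes x y :: "bool stream"
  assumes "dist x y < 1 / 2 ^ n"
  shows "stake (Suc n) x = stake (Suc n) y"
proof (cases "x = y")
  case False
  then obtain q \<alpha> x' y' where "x = q @- \<alpha> ## x'" "y = q @- (\<not> \<alpha>) ## y'"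
    by (rule stream_branch)
  then have d: "dist x y = 1 / 2 ^ length q"
    by (simp add: dist_branching)
  then have "n < length q"
    using assms half_power_le_iff[of n "length q"] by linarith
  then have "dist x y \<le> 1 / 2 ^ Suc n"
    unfolding d half_power_le_iff by simp
  then show ?thesis
    unfolding dist_le_iff_stake .
qed simp

text \<open>These |q| + 2 letters are q, \<open>\<alpha>\<close> and the first letter of the tail,
  hence all that determines the prefix of the image in \<open>represents\<close>.\<close>

lemma stake_branch_shd:
  assumes "z = q @- \<alpha> ## x" "stake (Suc (Suc (length q))) z = stake (Suc (Suc (length q))) z'"
  obtains x' where "z' = q @- \<alpha> ## x'" "shd x' = shd x"
proof
  have "stake (Suc (Suc (length q))) z' = q @ [\<alpha>, shd x]"
    using assms(2) by (subst (asm) assms(1)) (simp add: stake_shift numeral_2_eq_2)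
  then show "z' = q @- \<alpha> ## shd x ## sdrop (Suc (Suc (length q))) z'"
    using stake_sdrop[of "Suc (Suc (length q))" z'] by (simp del: stake.simps sdrop.simps)
qed simp

lemma dist_attained: "\<exists>n. dist x y = 1 / 2 ^ n" if "x \<noteq> y" for x y :: "bool stream"
  using that by (metis stream_branch dist_branching)

lemma dist_stream_le_1: "dist x y \<le> 1" for x y :: "bool stream"
  using dist_le_iff_stake[of x y 0] by simp

lemma dist_ultra: "dist x z \<le> max (dist x y) (dist y z)" for x y z :: "bool stream"
proof (cases "x = y \<or> y = z")
  case False
  then obtain m n where mn: "dist x y = 1 / 2 ^ m" "dist y z = 1 / 2 ^ n"
    using dist_attained by metis
  have "dist x y \<le> 1 / 2 ^ min m n" "dist y z \<le> 1 / 2 ^ min m n"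
    unfolding mn half_power_le_iff by auto
  then have "dist x z \<le> 1 / 2 ^ min m n"
    unfolding dist_le_iff_stake by simp
  then show ?thesis
    unfolding mn by (auto simp: min_def max_def half_power_le_iff split: if_splits)
qed auto

lemma dist_isosceles:
  fixes z u v :: "bool stream"
  assumes "dist z u < dist z v"
  shows "dist u v = dist z v"
  using dist_ultra[of u v z] dist_ultra[of z v u] assms by (simp add: dist_commute)

text \<open>Over a two-letter alphabet a sphere of radius 1/2^|q| is a single cylinder.\<close>

lemma dist_eq_branchE:
  fixes x u :: "bool stream"
  assumes "dist (q @- \<alpha> ## x) u = 1 / 2 ^ length q"
  obtains y where "u = q @- (\<not> \<alpha>) ## y"
proof -
  have "q @- \<alpha> ## x \<noteq> u"
    using assms by auto
  then obtain r \<beta> x' y where r: "q @- \<alpha> ## x = r @- \<beta> ## x'" "u = r @- (\<not> \<beta>) ## y"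
    by (rule stream_branch)
  have "(1::real) / 2 ^ length q = 1 / 2 ^ length r"
    using assms unfolding r dist_branching by simp
  then have len: "length q = length r"
    by (metis half_power_le_iff le_antisym order_refl)
  then have "q = r"
    using r(1) by (metis stake_shift diff_self_eq_0 append_Nil2 stake.simps(1) order_refl take_all)
  then show thesis
    using r that by auto
qed

section \<open>Topology of the word space: openness of balls and compactness\<close>

lemma open_cball_stream: "open (cball x (1 / 2 ^ n))" for x :: "bool stream"
proof (rule openI)
  fix y assume "y \<in> cball x (1 / 2 ^ n)"
  then have "ball y (1 / 2 ^ n) \<subseteq> cball x (1 / 2 ^ n)"
    unfolding mem_cball dist_le_iff_stake by (metis dist_le_iff_stake less_imp_le mem_ball mem_cball subsetI)
  then show "\<exists>e>0. ball y e \<subseteq> cball x (1 / 2 ^ n)"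
    by (intro exI[of _ "1 / 2 ^ n"]) auto
qed

text \<open>Tychonoff's theorem makes \<open>nat \<Rightarrow> bool\<close> compact, and the words
  are its continuous image under \<open>smap f nats\<close>.\<close>

lemma compact_UNIV_stream: "compact (UNIV :: bool stream set)"
proof -
  let ?F = "\<lambda>f::nat \<Rightarrow> bool. smap f nats"
  have "compact_space (product_topology (\<lambda>i::nat. euclidean :: bool topology) UNIV)"
    unfolding compact_space_product_topology
    by (simp add: compact_space_def finite_imp_compact)
  then have "compact (UNIV :: (nat \<Rightarrow> bool) set)"
    by (simp add: euclidean_product_topology compact_space_def)
  moreover have "continuous_on UNIV ?F"
    unfolding continuous_on_topological
  proof (intro ballI allI impI)
    fix f :: "nat \<Rightarrow> bool" and B assume "open B" "?F f \<in> B"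
    then obtain e where e: "e > 0" "ball (?F f) e \<subseteq> B"
      using open_contains_ball by blast
    obtain n where n: "(1 / 2) ^ n < e"
      using e(1) real_arch_pow_inv[of e "1/2"] by auto
    let ?A = "{g. \<forall>i\<in>{..<n}. g i \<in> {f i}}"
    have "open ?A"
      using product_topology_basis'[of "{..<n}" "\<lambda>i. {f i}" "\<lambda>i. i"]
      by (simp add: open_discrete)
    moreover have "?F g \<in> B" if "g \<in> ?A" for g
    proof -
      have "stake n (?F f) = stake n (?F g)"
        using that by (simp add: list_eq_iff_nth_eq)
      then have "dist (?F f) (?F g) \<le> 1 / 2 ^ n"
        unfolding dist_le_iff_stake .
      then show ?thesis
        using n e(2) by (auto simp: power_divide)
    qed
    ultimately show "\<exists>A. open A \<and> f \<in> A \<and> (\<forall>g\<in>UNIV. g \<in> A \<longrightarrow> ?F g \<in> B)"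
      by blast
  qed
  moreover have "range ?F = UNIV"
    by (metis stream_smap_nats surjI)
  ultimately show ?thesis
    by (metis compact_continuous_image)
qed

section \<open>The isometries encoded by a dilatation structure\<close>

text \<open>Stability from 0 on equates the scaled distances at p and at 0, where the dilatation is
  the identity.\<close>

lemma stable_from_0_dist:
  assumes "dilatation_structure \<delta> V U" "stable_from \<delta> 0"
  shows "dist (\<delta> (int p) x u) (\<delta> (int p) x v) = dist u v / 2 ^ p"
proof -
  have "2 ^ p * dist (\<delta> (int p) x u) (\<delta> (int p) x v)
      = 2 ^ 0 * dist (\<delta> (int 0) x u) (\<delta> (int 0) x v)"
    using assms(2) unfolding stable_from_def by (metis le0)
  also have "\<delta> (int 0) x = id"
    using assms(1) by (simp add: dilatation_structure_def axiom_A1_def)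
  finally show ?thesis
    by (simp add: field_simps)
qed

text \<open>For fixed p \<ge> 0 the pairs (x, y) fill a compact space, so the joint continuity in A1
  is uniform.\<close>

lemma dilatation_uniformly_continuous:
  assumes "dilatation_structure \<delta> V U" "p \<ge> 0"
  shows "uniformly_continuous_on UNIV (\<lambda>(x, y). \<delta> p x y)"
proof -
  have "continuous_on (dom_dil U) (\<lambda>(\<epsilon>, x, y). \<delta> (expo \<epsilon>) x y)"
    using assms(1) by (simp add: dilatation_structure_def axiom_A1_def)
  then have "continuous_on UNIV
      (\<lambda>z. (\<lambda>(\<epsilon>, x, y). \<delta> (expo \<epsilon>) x y) (Pow2 p, fst z, snd z :: bool stream))"
    by (rule continuous_on_compose2)
      (use assms(2) in \<open>auto simp: dom_dil_def intro!: continuous_intros\<close>)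
  moreover have "compact (UNIV :: (bool stream \<times> bool stream) set)"
    unfolding UNIV_Times_UNIV[symmetric] by (intro compact_Times compact_UNIV_stream)
  ultimately show ?thesis
    by (simp add: case_prod_beta' compact_uniformly_continuous)
qed

text \<open>Halving the distance to z makes the image leave z exactly one letter later than u
  does.\<close>

lemma half_similarity_branch:
  fixes z :: "bool stream"
  assumes "dist z (f u) = dist z u / 2" "z = q @- \<alpha> ## x" "u = q @- (\<not> \<alpha>) ## y"
  obtains w where "f u = q @- \<alpha> ## (\<not> shd x) ## w"
proof -
  have "dist ((q @ [\<alpha>]) @- shd x ## stl x) (f u) = 1 / 2 ^ length (q @ [\<alpha>])"
    using assms(1) dist_branching[of q \<alpha> x y] by (simp add: assms(2,3))
  then show thesis
    using that by (rule dist_eq_branchE) simp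
qed

lemma dilatation_structure_represented:
  assumes str: "dilatation_structure \<delta> V U" and p0: "is_p0 \<delta> 0"
  shows "\<exists>W. smooth_family W \<and> represents W (\<delta> 1)"
proof -
  \<comment> \<open>With k = |q| + 1, \<open>sph k z\<close> parametrizes the sphere of radius
    1/2^|q| around z; \<open>W\<close> then strips the |q| + 2 letters that the image is forced to
    begin with.\<close>
  define sph where "sph k z y = stake (k - 1) z @- (\<not> z !! (k - 1)) ## y" for k z and y :: "bool stream"
  define W where "W k z y = sdrop (Suc k) (\<delta> 1 z (sph k z y))" for k z y
  have half: "dist (\<delta> 1 z u) (\<delta> 1 z v) = dist u v / 2" for z u v
    using stable_from_0_dist[OF str, of 1] p0 by (simp add: is_p0_def)
  have base: "\<delta> 1 z z = z" for z
    using str by (simp add: dilatation_structure_def axiom_A1_def)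
  have half_base: "dist z (\<delta> 1 z u) = dist z u / 2" for z u
    using half[of z z u] by (simp add: base)
  have onto: "cball z (1 / 2) \<subseteq> range (\<delta> 1 z)" for z
  proof -
    have "\<forall>p::nat. cball z (1 / 2 ^ p) \<subseteq> range (\<delta> (int p) z)"
      using str by (simp add: dilatation_structure_def axiom_A0_def)
    from this[rule_format, of 1] show ?thesis
      by simp
  qed
  have sph: "sph (Suc (length q)) (q @- \<alpha> ## x) y = q @- (\<not> \<alpha>) ## y" for q \<alpha> x y
    by (simp add: sph_def stake_shift)
  have rep: "\<delta> 1 (q @- \<alpha> ## x) (q @- (\<not> \<alpha>) ## y) =
      q @- \<alpha> ## (\<not> shd x) ## W (Suc (length q)) (q @- \<alpha> ## x) y" for q \<alpha> x y
  proof -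
    obtain w where "\<delta> 1 (q @- \<alpha> ## x) (q @- (\<not> \<alpha>) ## y) = q @- \<alpha> ## (\<not> shd x) ## w"
      using half_similarity_branch[of _ "\<delta> 1 (q @- \<alpha> ## x)", OF half_base refl refl] .
    then show ?thesis
      by (simp add: W_def sph sdrop_shift numeral_2_eq_2)
  qed
  have split: "\<exists>q \<alpha> x. z = q @- \<alpha> ## x \<and> k = Suc (length q)" if "k \<ge> 1" for k and z :: "bool stream"
    using that id_stake_snth_sdrop[of z "k - 1"]
    by (intro exI[of _ "stake (k - 1) z"]) auto
  have "W k z \<in> Isom" if k: "k \<ge> 1" for k z
  proof -
    obtain q \<alpha> x where z: "z = q @- \<alpha> ## x" and k: "k = Suc (length q)"
      using split[OF k] by blast
    \<comment> \<open>Arguments share |q| + 1 letters and images |q| + 2; the extra letter absorbs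
      the ratio 1/2.\<close>
    have iso: "dist (W k z u) (W k z v) = dist u v" for u v
      using half[of z "q @- (\<not> \<alpha>) ## u" "q @- (\<not> \<alpha>) ## v"]
      unfolding z rep k dist_shift dist_SCons by simp
    \<comment> \<open>The word \<open>?t\<close> lies in the ball of radius 1/2, so A0 gives it a
      preimage, which \<open>half_base\<close> places on the sphere parametrized by y.\<close>
    have "\<exists>y. W k z y = w" for w
    proof -
      let ?t = "q @- \<alpha> ## (\<not> shd x) ## w"
      have "dist ((q @ [\<alpha>]) @- shd x ## stl x) ((q @ [\<alpha>]) @- (\<not> shd x) ## w)
          = 1 / 2 ^ length (q @ [\<alpha>])"
        by (rule dist_branching)
      then have d: "dist z ?t = 1 / 2 ^ length q / 2"
        by (simp add: z)
      also have "\<dots> \<le> 1 / 2"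
        using half_power_le_iff[of "length q" 0] by simp
      finally obtain u where u: "?t = \<delta> 1 z u"
        using onto[of z] by auto
      then have "dist (q @- \<alpha> ## x) u = 1 / 2 ^ length q"
        using d half_base[of z u] by (simp add: z)
      then obtain y where y: "u = q @- (\<not> \<alpha>) ## y"
        by (rule dist_eq_branchE)
      have "W k z y = w"
        using u unfolding y k z rep by simp
      then show ?thesis ..
    qed
    then have "surj (W k z)"
      by (metis surjI)
    moreover have "inj (W k z)"
      by (rule injI) (metis iso dist_eq_0_iff)
    ultimately show ?thesis
      by (simp add: Isom_def bij_def iso)
  qed
  moreover have "\<exists>\<mu>>0. \<forall>x x'. dist x x' < \<mu> \<longrightarrow> (\<forall>y. \<forall>k\<ge>1. dist x x' < 1 / 2 ^ k \<longrightarrow>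
           1 / 2 ^ k * dist (W k x y) (W k x' y) \<le> \<epsilon>)" if "\<epsilon> > 0" for \<epsilon>
  proof -
    \<comment> \<open>The distance of the images is 1/2^(k+1) times that of the values of
      \<open>W\<close>, one factor 1/2 more than in the definition of smoothness.\<close>
    have "\<epsilon> / 2 > 0"
      using that by simp
    then obtain \<mu> where "\<mu> > 0"
      and unif: "\<And>w w'. dist w' w < \<mu> \<Longrightarrow>
        dist (case w' of (x, y) \<Rightarrow> \<delta> 1 x y) (case w of (x, y) \<Rightarrow> \<delta> 1 x y) < \<epsilon> / 2"
      using dilatation_uniformly_continuous[OF str zero_le_one]
      unfolding uniformly_continuous_on_def by blast
    have \<mu>: "dist (\<delta> 1 x y) (\<delta> 1 x' y) < \<epsilon> / 2" if "dist x x' < \<mu>" for x x' y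
      using unif[of "(x, y)" "(x', y)"] that by (simp add: dist_Pair_Pair)
    have "1 / 2 ^ k * dist (W k z y) (W k z' y) \<le> \<epsilon>"
      if z: "dist z z' < \<mu>" and k: "k \<ge> 1" and zk: "dist z z' < 1 / 2 ^ k" for z z' y k
    proof -
      obtain q \<alpha> x where qx: "z = q @- \<alpha> ## x" and kq: "k = Suc (length q)"
        using split[OF k] by blast
      obtain x' where qx': "z' = q @- \<alpha> ## x'" and shd: "shd x' = shd x"
        using qx dist_less_imp_stake[OF zk] unfolding kq by (rule stake_branch_shd)
      show ?thesis
        using \<mu>[OF z, of "q @- (\<not> \<alpha>) ## y"]
        unfolding qx qx' rep shd kq dist_shift dist_SCons by simp
    qed
    with \<open>\<mu> > 0\<close> show ?thesis
      by blast
  qed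
  ultimately have "smooth_family W"
    by (simp add: smooth_family_def)
  moreover have "represents W (\<delta> 1)"
    by (simp add: represents_def rep)
  ultimately show ?thesis
    by blast
qed

section \<open>Dilatation structures generated by similarities of ratio 1/2\<close>

text \<open>The coefficients 2^p are isolated, so there each map is treated alone; near
  \<open>Zero\<close> the bound \<open>small\<close> makes the displacement tend to 0 uniformly in x
  and y.\<close>

lemma continuous_on_dil_closure:
  fixes \<delta> :: dilatations
  assumes cont: "\<And>p. continuous_on {(x, y). p < 0 \<longrightarrow> y \<in> U (nat (- p)) x} (\<lambda>(x, y). \<delta> p x y)"
    and small: "\<And>p x y. dist x (\<delta> (int p) x y) \<le> 1 / 2 ^ p"
  shows "continuous_on ({Zero} \<times> UNIV \<union> dom_dil U)
    (\<lambda>(\<epsilon>, x, y). case \<epsilon> of Zero \<Rightarrow> x | Pow2 p \<Rightarrow> \<delta> p x y)"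
    (is "continuous_on ?C ?F")
  unfolding continuous_on_topological
proof (intro ballI allI impI)
  fix z B assume z: "z \<in> ?C" and B: "open B" "?F z \<in> B"
  obtain \<epsilon> x y where zeq: "z = (\<epsilon>, x, y)"
    by (cases z)
  show "\<exists>A. open A \<and> z \<in> A \<and> (\<forall>z'\<in>?C. z' \<in> A \<longrightarrow> ?F z' \<in> B)"
  proof (cases \<epsilon>)
    case Zero
    then obtain e where e: "e > 0" "ball x e \<subseteq> B"
      using B unfolding zeq open_contains_ball by auto
    obtain n where n: "1 / 2 ^ n < e / 2"
      using e(1) real_arch_pow_inv[of "e / 2" "1/2"] by (auto simp: power_divide)
    \<comment> \<open>Exponents p > n displace points by at most 1/2^n < e/2; the other e/2 pays for
      moving x.\<close>
    let ?A = "insert Zero (Pow2 ` {int n<..}) \<times> ball x (e / 2) \<times> (UNIV :: bool stream set)"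
    have "open ?A"
      by (intro open_Times) (auto simp: open_scale_def)
    moreover have "?F z' \<in> B" if "z' \<in> ?A" for z'
    proof -
      from that obtain \<epsilon>' x' y' where z': "z' = (\<epsilon>', x', y')"
        and x': "dist x x' < e / 2" and \<epsilon>': "\<epsilon>' = Zero \<or> (\<exists>p>int n. \<epsilon>' = Pow2 p)"
        by auto
      have "dist x (?F z') < e"
        using \<epsilon>'
      proof
        assume "\<exists>p>int n. \<epsilon>' = Pow2 p"
        then obtain p where p: "p > int n" "\<epsilon>' = Pow2 p"
          by blast
        have "dist x' (\<delta> p x' y') \<le> 1 / 2 ^ nat p"
          using small[of x' "nat p" y'] p(1) by simp
        also have "\<dots> \<le> 1 / 2 ^ n"
          using p(1) by (simp only: half_power_le_iff)
        finally show ?thesis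
          using dist_triangle[of x "\<delta> p x' y'" x'] x' n p by (simp add: z')
      qed (use x' e in \<open>simp add: z'\<close>)
      then show ?thesis
        using e(2) by auto
    qed
    ultimately show ?thesis
      using Zero e(1) by (intro exI[of _ ?A]) (auto simp: zeq)
  next
    case (Pow2 p)
    then have "(x, y) \<in> {(x, y). p < 0 \<longrightarrow> y \<in> U (nat (- p)) x}" "\<delta> p x y \<in> B"
      using z B(2) by (auto simp: zeq dom_dil_def)
    then obtain A where A: "open A" "(x, y) \<in> A"
      "\<And>w. w \<in> {(x, y). p < 0 \<longrightarrow> y \<in> U (nat (- p)) x} \<Longrightarrow> w \<in> A \<Longrightarrow> (case w of (x, y) \<Rightarrow> \<delta> p x y) \<in> B"
      using cont[of p] B(1) unfolding continuous_on_topological by (smt (verit) case_prod_conv)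
    have "open ({Pow2 p} \<times> A)"
      using A(1) by (intro open_Times) (auto simp: open_scale_def)
    moreover have "?F z' \<in> B" if "z' \<in> ?C" "z' \<in> {Pow2 p} \<times> A" for z'
      using that A(3) by (force simp: dom_dil_def)
    ultimately show ?thesis
      using A(2) Pow2 zeq by blast
  qed
qed

text \<open>Points outside have some fixed p < 0 and violate the ball condition, which is an open
  condition. Hence the closure of the domain stays where the extension is continuous.\<close>

lemma closed_dil_closure:
  "closed ({Zero} \<times> UNIV \<union> dom_dil (\<lambda>p x. cball x (1 / 2 ^ p)))"
proof -
  have "- ({Zero} \<times> UNIV \<union> dom_dil (\<lambda>p x. cball x (1 / 2 ^ p))) =
      (\<Union>p\<in>{..<0}. {Pow2 p} \<times> {z. 1 / 2 ^ nat (- p) < dist (fst z) (snd z)})" (is "?L = ?R")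
  proof (rule set_eqI)
    fix z :: "scale \<times> bool stream \<times> bool stream"
    obtain \<epsilon> x y where "z = (\<epsilon>, x, y)"
      by (cases z)
    then show "z \<in> ?L \<longleftrightarrow> z \<in> ?R"
      by (cases \<epsilon>) (auto simp: dom_dil_def)
  qed
  moreover have "open {z :: bool stream \<times> bool stream. 1 / 2 ^ nat (- p) < dist (fst z) (snd z)}" for p
    by (intro open_Collect_less continuous_intros)
  then have "open ?R"
    by (intro open_UN ballI open_Times) (auto simp: open_scale_def)
  ultimately show ?thesis
    by (simp add: closed_def)
qed

text \<open>Interface for the converse direction: a smooth family enters through these properties of
  the represented maps, and all axioms are derived from them.\<close>

locale half_similarities =
  fixes f :: "bool stream \<Rightarrow> bool stream \<Rightarrow> bool stream"
  assumes base: "f x x = x"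
    and dist_half: "dist (f x u) (f x v) = dist u v / 2"
    and cball_subset_range: "cball x (1 / 2) \<subseteq> range (f x)"
    and continuous: "continuous_on UNIV (\<lambda>(x, y). f x y)"
begin

section \<open>Iterates of the similarities and their inverses\<close>

lemma pow_base: "(f x ^^ n) x = x"
  by (induction n) (simp_all add: base)

lemma dist_pow: "dist ((f x ^^ n) u) ((f x ^^ n) v) = dist u v / 2 ^ n"
  by (induction n) (simp_all add: dist_half)

lemma dist_pow_base: "dist x ((f x ^^ n) u) = dist x u / 2 ^ n"
  using dist_pow[where x = x and u = x] by (simp add: pow_base)

lemma dist_pow_base_le: "dist x ((f x ^^ n) u) \<le> 1 / 2 ^ n"
  unfolding dist_pow_base by (simp add: divide_right_mono dist_stream_le_1)

lemma inj_pow: "inj (f x ^^ n)"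
proof (rule injI)
  fix u v assume "(f x ^^ n) u = (f x ^^ n) v"
  then show "u = v"
    using dist_pow[of n x u v] by simp
qed

text \<open>Induction on n: a word within 1/2^(n+1) of x has a preimage under \<open>f x\<close>,
  and its distance to the fixed point x is twice as large, hence at most 1/2^n.\<close>

lemma range_pow: "range (f x ^^ n) = cball x (1 / 2 ^ n)"
proof
  show "range (f x ^^ n) \<subseteq> cball x (1 / 2 ^ n)"
    using dist_pow_base_le by auto
  show "cball x (1 / 2 ^ n) \<subseteq> range (f x ^^ n)"
  proof (induction n)
    case (Suc n)
    show ?case
    proof
      fix w assume w: "w \<in> cball x (1 / 2 ^ Suc n)"
      have "(1::real) / 2 ^ Suc n \<le> 1 / 2"
        using half_power_le_iff[of "Suc n" 1] by simp
      with w have "w \<in> cball x (1 / 2)"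
        unfolding mem_cball by (rule order_trans)
      then obtain v where v: "w = f x v"
        using cball_subset_range by blast
      then have "v \<in> cball x (1 / 2 ^ n)"
        using w dist_half[of x x v] by (simp add: base)
      then obtain u where "v = (f x ^^ n) u"
        using Suc.IH by blast
      then have "w = (f x ^^ Suc n) u"
        by (simp add: v)
      then show "w \<in> range (f x ^^ Suc n)"
        by blast
    qed
  qed simp
qed

lemma continuous_pow: "continuous_on UNIV (\<lambda>z. (f (fst z) ^^ n) (snd z))"
proof (induction n)
  case (Suc n)
  have "continuous_on UNIV (\<lambda>z. case (fst z, (f (fst z) ^^ n) (snd z)) of (x, y) \<Rightarrow> f x y)"
    by (rule continuous_on_compose2[OF continuous]) (auto intro!: continuous_intros Suc.IH)
  then show ?case
    by simp
qed (auto intro!: continuous_intros)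

text \<open>With \<open>a\<close> the preimage of \<open>y\<close>, the preimages of \<open>y'\<close> (based at \<open>x'\<close>) and \<open>y\<close> have distance
  \<open>2\<^sup>n dist y' ((f x' ^^ n) a)\<close>, which no longer involves an inverse.\<close>

lemma continuous_inv_pow:
  "continuous_on {z. snd z \<in> range (f (fst z) ^^ n)} (\<lambda>z. inv (f (fst z) ^^ n) (snd z))"
  (is "continuous_on ?S ?g")
  unfolding continuous_on_def
proof
  fix z assume z: "z \<in> ?S"
  define h where "h w = 2 ^ n * dist (snd w) ((f (fst w) ^^ n) (?g z))" for w
  have "continuous_on UNIV (\<lambda>w. (f (fst w) ^^ n) (?g z))"
    using continuous_on_compose2[OF continuous_pow, of UNIV "\<lambda>w. (fst w, ?g z)" n]
    by (simp add: continuous_on_Pair continuous_on_fst continuous_on_id)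
  then have "continuous_on UNIV h"
    unfolding h_def by (intro continuous_intros)
  then have "(h \<longlongrightarrow> h z) (at z within UNIV)"
    unfolding continuous_on_def by blast
  then have "(h \<longlongrightarrow> h z) (at z within ?S)"
    by (rule tendsto_within_subset) simp
  moreover have "h z = 0"
    using z by (simp add: h_def f_inv_into_f)
  ultimately have "(h \<longlongrightarrow> 0) (at z within ?S)"
    by simp
  moreover have "dist (?g w) (?g z) = h w" if "w \<in> ?S" for w
    using that dist_pow[of n "fst w" "?g w" "?g z"] by (simp add: h_def f_inv_into_f)
  then have "\<forall>\<^sub>F w in at z within ?S. h w = dist (?g w) (?g z)"
    by (simp add: eventually_at_filter)
  ultimately have "((\<lambda>w. dist (?g w) (?g z)) \<longlongrightarrow> 0) (at z within ?S)"
    by (rule Lim_transform_eventually)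
  then show "(?g \<longlongrightarrow> ?g z) (at z within ?S)"
    by (rule tendsto_dist_iff[THEN iffD2])
qed

section \<open>The axioms for the induced dilatations\<close>

lemma induced_nat: "induced f (int p) x = f x ^^ p"
  by (simp add: induced_def)

lemma induced_neg: "p \<ge> 1 \<Longrightarrow> induced f (- int p) x = inv (f x ^^ p)"
  by (simp add: induced_def)

lemma continuous_induced:
  "continuous_on {(x, y). p < 0 \<longrightarrow> y \<in> induced_domains f (nat (- p)) x} (\<lambda>(x, y). induced f p x y)"
proof (cases "p < 0")
  case True
  then show ?thesis
    using continuous_inv_pow[of "nat (- p)"]
    by (simp add: induced_def induced_domains_def case_prod_beta')
next
  case False
  then show ?thesis
    using continuous_pow[of "nat p"] by (simp add: induced_def case_prod_beta')
qed

lemma induced_domains_eq: "induced_domains f = (\<lambda>p x. cball x (1 / 2 ^ p))"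
  by (intro ext) (simp add: induced_domains_def range_pow)

lemma induced_A0: "axiom_A0 (induced f) (induced_domains f) (induced_domains f)"
  unfolding axiom_A0_def induced_nat
proof (intro conjI allI impI)
  fix p :: nat and x
  show "open (induced_domains f p x)" "x \<in> induced_domains f p x"
    by (simp_all add: induced_domains_eq open_cball_stream)
  show "cball x (1 / 2 ^ p) \<subseteq> range (f x ^^ p)" "range (f x ^^ p) \<subseteq> induced_domains f p x"
    by (simp_all add: range_pow induced_domains_eq)
  have "continuous_on UNIV (f x ^^ p)"
    using continuous_on_compose2[OF continuous_pow, of UNIV "\<lambda>y. (x, y)" p]
    by (simp add: continuous_on_Pair)
  moreover have "continuous_on (range (f x ^^ p)) (inv (f x ^^ p))"
    using continuous_on_compose2[OF continuous_inv_pow, of "range (f x ^^ p)" "\<lambda>y. (x, y)" p]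
    by (simp add: continuous_on_Pair image_subset_iff)
  ultimately have "homeomorphism UNIV (induced_domains f p x) (f x ^^ p) (inv (f x ^^ p))"
    by (simp add: homeomorphism_def induced_domains_def f_inv_into_f inv_f_f[OF inj_pow]
        image_comp comp_def)
  then show "\<exists>g. homeomorphism UNIV (induced_domains f p x) (f x ^^ p) g"
    by blast
next
  fix p :: nat and x u assume p: "p \<ge> 1"
  show "open (induced_domains f p x)" "x \<in> induced_domains f p x"
    "induced_domains f p x \<subseteq> induced_domains f p x"
    by (simp_all add: induced_domains_eq open_cball_stream)
  show "inj_on (induced f (- int p) x) (induced_domains f p x)"
    by (simp add: induced_neg[OF p] induced_domains_def inj_on_inv_into)
  show "induced f (- int p) x ((f x ^^ p) u) = u"
    by (simp add: induced_neg[OF p] inv_f_f[OF inj_pow])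
next
  \<comment> \<open>R = 1 and p1 = 0 work: the space has diameter at most 1, so any two images under
    \<open>f x ^^ p\<close> are within 1/2^p.\<close>
  show "\<exists>R>0. \<exists>p1. \<forall>x. \<forall>u\<in>cball x R. \<forall>v\<in>cball x R. \<forall>p>p1.
        (f x ^^ p) v \<in> induced_domains f p ((f x ^^ p) u)"
    by (intro exI[of _ 1] exI[of _ 0])
      (simp add: induced_domains_eq dist_pow divide_right_mono dist_stream_le_1)
qed

lemma induced_A1: "axiom_A1 (induced f) (induced_domains f)"
proof -
  let ?D = "dom_dil (induced_domains f)"
  let ?F = "\<lambda>(\<epsilon>, x, y). case \<epsilon> of Zero \<Rightarrow> x | Pow2 p \<Rightarrow> induced f p x y"
  \<comment> \<open>\<open>?F\<close> is continuous on a closed set containing \<open>?D\<close>,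
    hence on the closure; its restriction to \<open>?D\<close> gives the continuity of the
    dilatations.\<close>
  have "closed ({Zero} \<times> UNIV \<union> ?D)"
    unfolding induced_domains_eq by (rule closed_dil_closure)
  then have "closure ?D \<subseteq> {Zero} \<times> UNIV \<union> ?D"
    by (intro closure_minimal) auto
  then have F: "continuous_on (closure ?D) ?F"
    by (rule continuous_on_subset[rotated])
      (intro continuous_on_dil_closure continuous_induced, simp add: induced_nat dist_pow_base_le)
  have F_eq: "?F z = (case z of (\<epsilon>, x, y) \<Rightarrow> induced f (expo \<epsilon>) x y)" if "z \<in> ?D" for z
    using that by (auto simp: dom_dil_def)
  have "continuous_on ?D ?F"
    using F closure_subset by (rule continuous_on_subset)
  then have "continuous_on ?D (\<lambda>(\<epsilon>, x, y). induced f (expo \<epsilon>) x y)"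
    by (rule continuous_on_cong[THEN iffD1, rotated -1]) (simp_all add: F_eq)
  moreover have "\<exists>F. continuous_on (closure ?D) F \<and>
      (\<forall>(\<epsilon>, x, y)\<in>?D. F (\<epsilon>, x, y) = induced f (expo \<epsilon>) x y)"
    using F F_eq by (intro exI[of _ ?F]) auto
  moreover have "induced f p x x = x" for p x
    by (simp add: induced_def pow_base inv_f_eq[OF inj_pow])
  moreover have "((\<lambda>p. induced f p x y) \<longlongrightarrow> x) at_top" for x y
    unfolding tendsto_iff eventually_at_top_linorder
  proof (intro allI impI)
    fix e :: real assume "e > 0"
    then obtain n where n: "1 / 2 ^ n < e"
      using real_arch_pow_inv[of e "1/2"] by (auto simp: power_divide)
    have "dist (induced f p x y) x < e" if "p \<ge> int n" for p
    proof -
      have "dist x (induced f p x y) \<le> 1 / 2 ^ nat p"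
        using that dist_pow_base_le[of x "nat p" y] by (simp add: induced_def)
      also have "\<dots> \<le> 1 / 2 ^ n"
        using that by (simp only: half_power_le_iff)
      finally show ?thesis
        using n by (simp add: dist_commute)
    qed
    then show "\<exists>N. \<forall>p\<ge>N. dist (induced f p x y) x < e"
      by blast
  qed
  moreover have "induced f 0 x = id" for x
    by (simp add: induced_def)
  ultimately show ?thesis
    unfolding axiom_A1_def by blast
qed

text \<open>The sequence in A3 is constant, so the tangent distance is \<open>dist\<close> itself;
  A3 and p_0 = 0 both follow.\<close>

lemma scaled_dist_induced: "2 ^ p * dist (induced f (int p) x u) (induced f (int p) x v) = dist u v"
  by (simp add: induced_nat dist_pow)

theorem dilatation_structure_induced:
  "dilatation_structure (induced f) (induced_domains f) (induced_domains f)"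
proof -
  have "axiom_A2 (induced f)"
    by (simp add: axiom_A2_def induced_nat funpow_add del: of_nat_add)
  moreover have "axiom_A3 (induced f)"
    unfolding axiom_A3_def scaled_dist_induced
    by (intro exI[of _ "\<lambda>_ u v. dist u v"]) (auto intro: uniform_limit_const)
  ultimately show ?thesis
    by (simp add: dilatation_structure_def induced_A0 induced_A1)
qed

theorem is_p0_induced: "is_p0 (induced f) 0"
  by (simp add: is_p0_def stable_from_def tangent_dist_def scaled_dist_induced)

end

section \<open>The similarities represented by a smooth family\<close>

lemma represents_unique:
  assumes "\<And>x. f x x = x" "represents W f" "\<And>x. g x x = x" "represents W g"
  shows "f = g"
proof (intro ext)
  fix x u :: "bool stream"
  show "f x u = g x u"
  proof (cases "x = u")
    case False
    then obtain q \<alpha> x' y where "x = q @- \<alpha> ## x'" "u = q @- (\<not> \<alpha>) ## y"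
      by (rule stream_branch)
    then show ?thesis
      using assms by (simp add: represents_def)
  qed (simp add: assms)
qed

lemma represents_exists: "\<exists>f. (\<forall>x. f x x = x) \<and> represents W f"
proof -
  \<comment> \<open>Here n is |q|, so \<open>stake (Suc n) x\<close> is q followed by
    \<open>\<alpha>\<close>, \<open>x !! Suc n\<close> is the letter to be negated, and
    \<open>sdrop (Suc n) u\<close> is y.\<close>
  define f where "f x u = (if x = u then x else
      let n = LEAST n. x !! n \<noteq> u !! n in
      stake (Suc n) x @- (\<not> x !! Suc n) ## W (Suc n) x (sdrop (Suc n) u))"
    for x u :: "bool stream"
  have "f (q @- \<alpha> ## x) (q @- (\<not> \<alpha>) ## y) = q @- \<alpha> ## (\<not> shd x) ## W (length q + 1) (q @- \<alpha> ## x) y"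
    for q \<alpha> x y
  proof -
    let ?x = "q @- \<alpha> ## x" and ?u = "q @- (\<not> \<alpha>) ## y"
    have ne: "?x !! length q \<noteq> ?u !! length q"
      by simp
    have "(LEAST n. ?x !! n \<noteq> ?u !! n) = length q"
    proof (rule Least_equality)
      fix n assume "?x !! n \<noteq> ?u !! n"
      then show "length q \<le> n"
        by (cases "n < length q") simp_all
    qed (rule ne)
    moreover have "?x \<noteq> ?u"
      using ne by metis
    have app: "stake (length r) (r @- s) = r" "(r @- s) !! length r = shd s"
      "sdrop (length r) (r @- s) = s" for r and s :: "bool stream"
      by (simp_all add: stake_shift sdrop_shift)
    moreover have "stake (Suc (length q)) ?x = q @ [\<alpha>]" "?x !! Suc (length q) = shd x"
      "sdrop (Suc (length q)) ?u = y"
      using app[of "q @ [\<alpha>]" x] app[of "q @ [\<not> \<alpha>]" y]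
      by (simp_all del: stake.simps sdrop.simps snth.simps)
    ultimately show ?thesis
      by (simp add: f_def Let_def del: stake.simps sdrop.simps)
  qed
  then have "represents W f"
    by (simp add: represents_def)
  moreover have "\<forall>x. f x x = x"
    by (simp add: f_def)
  ultimately show ?thesis
    by blast
qed

lemma represents_dist_base:
  assumes "\<And>x. f x x = x" "represents W f"
  shows "dist z (f z u) = dist z u / 2"
proof (cases "z = u")
  case False
  then obtain q \<alpha> x y where zu: "z = q @- \<alpha> ## x" "u = q @- (\<not> \<alpha>) ## y"
    by (rule stream_branch)
  let ?w = "W (length q + 1) z y"
  have "dist ((q @ [\<alpha>]) @- shd x ## stl x) ((q @ [\<alpha>]) @- (\<not> shd x) ## ?w) = 1 / 2 ^ length (q @ [\<alpha>])"
    by (rule dist_branching)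
  then show ?thesis
    using assms(2) dist_branching[of q \<alpha> x y] by (simp add: represents_def zu)
qed (simp add: assms)

lemma represents_dist_half:
  assumes base: "\<And>x. f x x = x" and rep: "represents W f"
    and isom: "\<And>k x. k \<ge> 1 \<Longrightarrow> W k x \<in> Isom"
  shows "dist (f z u) (f z v) = dist u v / 2"
proof -
  note db = represents_dist_base[OF base rep]
  \<comment> \<open>For points on different spheres around z the larger radius is the distance,
    before and after the map, and \<open>db\<close> halves the radii.\<close>
  have less: "dist (f z u) (f z v) = dist u v / 2" if "dist z u < dist z v" for u v
    using dist_isosceles[OF that] dist_isosceles[of z "f z u" "f z v"] that by (simp add: db)
  show ?thesis
  proof (cases "dist z u" "dist z v" rule: linorder_cases)
    case equal
    show ?thesis
    proof (cases "z = u")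
      case False
      then obtain q \<alpha> x y where zu: "z = q @- \<alpha> ## x" "u = q @- (\<not> \<alpha>) ## y"
        by (rule stream_branch)
      then obtain y' where v: "v = q @- (\<not> \<alpha>) ## y'"
        using equal dist_branching[of q \<alpha> x y] dist_eq_branchE[of q \<alpha> x v] by metis
      have f: "f z (q @- (\<not> \<alpha>) ## t) = q @- \<alpha> ## (\<not> shd x) ## W (length q + 1) z t" for t
        using rep by (simp add: represents_def zu)
      have "dist (W (length q + 1) z y) (W (length q + 1) z y') = dist y y'"
        using isom[of "length q + 1" z] by (simp add: Isom_def)
      then show ?thesis
        unfolding zu(2) v f dist_shift dist_SCons by simp
    qed (use equal in simp)
  qed (use less[of u v] less[of v u] in \<open>simp_all add: dist_commute\<close>)
qed

lemma represents_range:
  assumes base: "\<And>x. f x x = x" and rep: "represents W f"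
    and isom: "\<And>k x. k \<ge> 1 \<Longrightarrow> W k x \<in> Isom"
  shows "cball z (1 / 2) \<subseteq> range (f z)"
proof
  fix w assume w: "w \<in> cball z (1 / 2)"
  show "w \<in> range (f z)"
  proof (cases "z = w")
    case True
    then show ?thesis
      using base[of z] by (metis rangeI)
  next
    case False
    then obtain r \<beta> x t where zw: "z = r @- \<beta> ## x" "w = r @- (\<not> \<beta>) ## t"
      by (rule stream_branch)
    \<comment> \<open>Radius 1/2 excludes branching at the first letter. The preimage leaves z at
      the last letter of r, and surjectivity of \<open>W\<close> supplies its tail.\<close>
    have "r \<noteq> []"
      using w dist_branching[of r \<beta> x t] by (auto simp: zw)
    then obtain q \<alpha> where r: "r = q @ [\<alpha>]"
      by (metis rev_exhaust)
    have "surj (W (length q + 1) z)"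
      using isom[of "length q + 1" z] by (simp add: Isom_def bij_def)
    then obtain y where "t = W (length q + 1) z y"
      by blast
    then have "f z (q @- (\<not> \<alpha>) ## y) = w"
      using rep by (simp add: represents_def zw r)
    then show ?thesis
      by blast
  qed
qed

text \<open>Smoothness handles those u that are far from z compared with z'; for a nearby u both
  images stay close to the base points by \<open>represents_dist_base\<close>.\<close>

lemma represents_equicontinuous:
  assumes base: "\<And>x. f x x = x" and rep: "represents W f" and smooth: "smooth_family W"
    and "\<epsilon> > 0"
  shows "\<exists>\<mu>>0. \<forall>z z' u. dist z z' < \<mu> \<longrightarrow> dist (f z u) (f z' u) \<le> \<epsilon>"
proof -
  note db = represents_dist_base[OF base rep]
  obtain \<mu> where "\<mu> > 0" and \<mu>: "\<And>x x' y k. dist x x' < \<mu> \<Longrightarrow> k \<ge> 1 \<Longrightarrow> dist x x' < 1 / 2 ^ k \<Longrightarrow>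
           1 / 2 ^ k * dist (W k x y) (W k x' y) \<le> \<epsilon>"
    using smooth \<open>\<epsilon> > 0\<close> unfolding smooth_family_def by meson
  \<comment> \<open>The bound \<epsilon> / 4 matches the estimate 4 * \<open>dist z z'\<close> for
    nearby u.\<close>
  have "dist (f z u) (f z' u) \<le> \<epsilon>" if zz': "dist z z' < min \<mu> (\<epsilon> / 4)" for z z' u
  proof (cases "dist z u \<le> 2 * dist z z'")
    case True
    have "dist (f z u) (f z' u) \<le> dist (f z u) z + dist z z' + dist z' (f z' u)"
      using dist_triangle[of "f z u" "f z' u" z] dist_triangle[of z "f z' u" z'] by linarith
    also have "\<dots> = dist z u / 2 + dist z z' + dist z' u / 2"
      using db[of z u] db[of z' u] by (simp add: dist_commute)
    also have "\<dots> \<le> 4 * dist z z'"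
      using True dist_triangle[of z' u z] dist_commute[of z z'] zero_le_dist[of z z']
      by linarith
    finally show ?thesis
      using zz' by linarith
  next
    case False
    then have "z \<noteq> u"
      by auto
    then obtain q \<alpha> x y where zu: "z = q @- \<alpha> ## x" "u = q @- (\<not> \<alpha>) ## y"
      by (rule stream_branch)
    let ?k = "Suc (length q)"
    \<comment> \<open>Since \<open>dist z u\<close> is 1/2^|q|, the failed case condition is
      precisely the proviso of smoothness at index |q| + 1.\<close>
    have zk: "dist z z' < 1 / 2 ^ ?k"
      using False dist_branching[of q \<alpha> x y] by (simp add: zu)
    obtain x' where z': "z' = q @- \<alpha> ## x'" and shd: "shd x' = shd x"
      using zu(1) dist_less_imp_stake[OF zk] by (rule stake_branch_shd)
    have "dist (f z u) (f z' u) = 1 / 2 ^ ?k * dist (W ?k z y) (W ?k z' y) / 2"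
      using rep unfolding represents_def zu z' by (simp add: shd dist_shift dist_SCons)
    also have "\<dots> \<le> \<epsilon>"
      using \<mu>[of z z' ?k y] zk zz' \<open>\<epsilon> > 0\<close> by simp
    finally show ?thesis .
  qed
  moreover have "min \<mu> (\<epsilon> / 4) > 0"
    using \<open>\<mu> > 0\<close> \<open>\<epsilon> > 0\<close> by simp
  ultimately show ?thesis
    by blast
qed

lemma represents_half_similarities:
  assumes base: "\<And>x. f x x = x" and rep: "represents W f" and smooth: "smooth_family W"
  shows "half_similarities f"
proof
  have isom: "W k x \<in> Isom" if "k \<ge> 1" for k x
    using smooth that by (simp add: smooth_family_def)
  show half: "dist (f x u) (f x v) = dist u v / 2" for x u v
    using base rep isom by (rule represents_dist_half)
  show "cball x (1 / 2) \<subseteq> range (f x)" for x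
    using base rep isom by (rule represents_range)
  show "continuous_on UNIV (\<lambda>(x, y). f x y)"
    unfolding continuous_on_iff
  proof (intro ballI allI impI)
    fix z :: "bool stream \<times> bool stream" and \<epsilon> :: real assume "\<epsilon> > 0"
    obtain x u where z: "z = (x, u)"
      by (cases z)
    from \<open>\<epsilon> > 0\<close> have "\<epsilon> / 2 > 0"
      by simp
    then obtain \<mu> where "\<mu> > 0" and \<mu>: "\<And>z z' u. dist z z' < \<mu> \<Longrightarrow> dist (f z u) (f z' u) \<le> \<epsilon> / 2"
      using represents_equicontinuous[OF base rep smooth] by blast
    \<comment> \<open>First the base point moves, at a cost uniform in the argument; then the
      argument, whose displacement is halved.\<close>
    have "dist (f x' u') (f x u) < \<epsilon>" if "dist (x', u') (x, u) < min \<mu> \<epsilon>" for x' u'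
    proof -
      have "dist x' x < \<mu>" "dist u' u < \<epsilon>"
        using that dist_fst_le[of "(x', u')" "(x, u)"] dist_snd_le[of "(x', u')" "(x, u)"] by auto
      then have "dist (f x' u') (f x u') \<le> \<epsilon> / 2" "dist (f x u') (f x u) < \<epsilon> / 2"
        using \<mu> by (auto simp: half)
      then show ?thesis
        using dist_triangle[of "f x' u'" "f x u" "f x u'"] by linarith
    qed
    with \<open>\<mu> > 0\<close> \<open>\<epsilon> > 0\<close> show "\<exists>d>0. \<forall>w\<in>UNIV. dist w z < d \<longrightarrow>
        dist (case w of (x, y) \<Rightarrow> f x y) (case z of (x, y) \<Rightarrow> f x y) < \<epsilon>"
      unfolding z by (intro exI[of _ "min \<mu> \<epsilon>"]) auto
  qed
qed (rule base)

text \<open>Unique existence makes precise that the base condition and \<open>represents\<close>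
  define \<open>\<delta>2\<close>. \<open>induced_domains\<close> occurs twice because the image of
  each map is also the domain of its inverse.\<close>

theorem theorem6p5:
  "(\<forall>\<delta> V U. dilatation_structure \<delta> V U \<and> is_p0 \<delta> 0 \<longrightarrow>
      (\<exists>W. smooth_family W \<and> represents W (\<delta> 1))) \<and>
   (\<forall>W. smooth_family W \<longrightarrow>
      (\<exists>!\<delta>2. (\<forall>x. \<delta>2 x x = x) \<and> represents W \<delta>2) \<and>
      (\<forall>\<delta>2. (\<forall>x. \<delta>2 x x = x) \<and> represents W \<delta>2 \<longrightarrow>
         dilatation_structure (induced \<delta>2) (induced_domains \<delta>2) (induced_domains \<delta>2) \<and>
         is_p0 (induced \<delta>2) 0))"
proof (intro conjI allI impI)
  fix \<delta> V U
  assume "dilatation_structure \<delta> V U \<and> is_p0 \<delta> 0"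
  then show "\<exists>W. smooth_family W \<and> represents W (\<delta> 1)"
    using dilatation_structure_represented by blast
next
  fix W
  show "\<exists>!\<delta>2. (\<forall>x. \<delta>2 x x = x) \<and> represents W \<delta>2"
  proof (rule ex_ex1I)
    show "\<exists>\<delta>2. (\<forall>x. \<delta>2 x x = x) \<and> represents W \<delta>2"
      by (rule represents_exists)
  qed (auto intro: represents_unique)
next
  fix W \<delta>2
  assume "smooth_family W" "(\<forall>x. \<delta>2 x x = x) \<and> represents W \<delta>2"
  then interpret half_similarities \<delta>2
    by (intro represents_half_similarities) auto
  show "dilatation_structure (induced \<delta>2) (induced_domains \<delta>2) (induced_domains \<delta>2)"
    by (rule dilatation_structure_induced)
  show "is_p0 (induced \<delta>2) 0"
    by (rule is_p0_induced)
qed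

end
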